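(* Let $c\in\mathbb{C}$, $c\neq0$. The set of iterating elements of the three-valued group $\mathbb{G}_{3,c}(\mathbb{C}P^1)$ is $\{0,\pm1/\sqrt c\}$, and this set is, as a three-valued subgroup, the diagonal construction of a single-valued group isomorphic to $\mathbb{Z}/3$.
   Context: $\mathbb{C}P^1=\mathbb{C}\cup\{\infty\}$, $x=x_1/x_0$ for $(x_1:x_0)$, $\infty=(1:0)$. $\mathrm{Sym}^3(X)$ is the set of 3-element multisets $[z_1,z_2,z_3]$ of elements of $X$. Let $$p_{3,c}(z;x,y)=\sigma_1^3-27\sigma_3+18c\,\sigma_1^2\sigma_3-54c\,\sigma_2\sigma_3-27c^2\sigma_2^2\sigma_3+81c^2\sigma_1\sigma_3^2,$$ $\sigma_k$ being the elementary symmetric functions of $x,y,z$. $\mathbb{G}_{3,c}(\mathbb{C}P^1)$ is $\mathbb{C}P^1$ with the three-valued multiplication $\ast:\mathbb{C}P^1\times\mathbb{C}P^1\to\mathrm{Sym}^3(\mathbb{C}P^1)$ in which $(x_1:x_0)\ast(y_1:y_0)$ is the multiset of zeros (with multiplicity) in $(z_1:z_0)$ of the form $(x_0y_0z_0)^3p_{3,c}(z_1/z_0;-x_1/x_0,-y_1/y_0)$. It is an everywhere defined, associative, commutative multiplication with neutral element $0$ and inverse $\mathrm{inv}(x)=-x$. An element $w$ of an $n$-valued group is iterating if for every element $m$ each of the multisets $w\ast m$ and $m\ast w$ contains some element (depending on $m$) with multiplicity at least $2$. The ($n$-)diagonal construction of a single-valued group $G$ is the $n$-valued group on $G$ with $g_1\ast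 g_2=[g_1g_2,\dots,g_1g_2]$ ($n$ times). *)

theory Defs
  imports
    Complex_Main
    "HOL-Library.Multiset"
    "HOL-Computational_Algebra.Polynomial"
    "HOL-Algebra.Elementary_Groups"
begin

text \<open>
  Structures with a multiset-valued multiplication. \<open>n_valued_group n G\<close> states the axioms of an
  n-valued group; in the associativity law both sides are multisets of \<open>n\<^sup>2\<close> elements.
\<close>

record 'a mv_group = "'a partial_object" +
  mv_mult :: "'a \<Rightarrow> 'a \<Rightarrow> 'a multiset"
  mv_one :: 'a
  mv_inv :: "'a \<Rightarrow> 'a"

definition n_valued_group :: "nat \<Rightarrow> ('a, 'b) mv_group_scheme \<Rightarrow> bool" where
  "n_valued_group n G \<longleftrightarrow>
     (\<forall>x\<in>carrier G. \<forall>y\<in>carrier G.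
        size (mv_mult G x y) = n \<and> set_mset (mv_mult G x y) \<subseteq> carrier G) \<and>
     (\<forall>x\<in>carrier G. \<forall>y\<in>carrier G. \<forall>z\<in>carrier G.
        (\<Sum>u\<in>#mv_mult G x y. mv_mult G u z) = (\<Sum>v\<in>#mv_mult G y z. mv_mult G x v)) \<and>
     mv_one G \<in> carrier G \<and>
     (\<forall>x\<in>carrier G. mv_mult G (mv_one G) x = replicate_mset n x \<and>
        mv_mult G x (mv_one G) = replicate_mset n x) \<and>
     (\<forall>x\<in>carrier G. mv_inv G x \<in> carrier G \<and>
        mv_one G \<in># mv_mult G x (mv_inv G x) \<and> mv_one G \<in># mv_mult G (mv_inv G x) x)"

definition n_valued_subgroup :: "nat \<Rightarrow> 'a set \<Rightarrow> ('a, 'b) mv_group_scheme \<Rightarrow> bool" where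
  "n_valued_subgroup n H G \<longleftrightarrow> H \<subseteq> carrier G \<and> n_valued_group n (G\<lparr>carrier := H\<rparr>)"

definition iterating :: "('a, 'b) mv_group_scheme \<Rightarrow> 'a \<Rightarrow> bool" where
  "iterating G w \<longleftrightarrow> w \<in> carrier G \<and>
     (\<forall>m\<in>carrier G. (\<exists>u. count (mv_mult G w m) u \<ge> 2) \<and> (\<exists>u. count (mv_mult G m w) u \<ge> 2))"

definition diagonal_construction :: "nat \<Rightarrow> ('a, 'b) monoid_scheme \<Rightarrow> 'a mv_group" where
  "diagonal_construction n K =
     \<lparr>carrier = carrier K,
      mv_mult = (\<lambda>x y. replicate_mset n (x \<otimes>\<^bsub>K\<^esub> y)),
      mv_one = \<one>\<^bsub>K\<^esub>,
      mv_inv = (\<lambda>x. inv\<^bsub>K\<^esub> x)\<rparr>"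

text \<open>
  Equality of structures; the operations are compared on the common carrier only, since their values
  elsewhere are irrelevant.
\<close>

definition mv_group_eq ::
    "('a, 'b) mv_group_scheme \<Rightarrow> ('a, 'c) mv_group_scheme \<Rightarrow> bool" where
  "mv_group_eq G G' \<longleftrightarrow> carrier G = carrier G' \<and>
     (\<forall>x\<in>carrier G. \<forall>y\<in>carrier G. mv_mult G x y = mv_mult G' x y) \<and>
     mv_one G = mv_one G' \<and>
     (\<forall>x\<in>carrier G. mv_inv G x = mv_inv G' x)"


text \<open>
  The projective line as \<open>\<complex> \<union> {\<infinity>}\<close>. Homogeneous coordinates are written \<open>(x\<^sub>1, x\<^sub>0)\<close>, with affine
  coordinate \<open>x\<^sub>1 / x\<^sub>0\<close>; the choice of representative is immaterial by \<open>p3_form_scale\<close> below.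
\<close>

datatype cp1 = Aff complex | Infty

fun hcoords :: "cp1 \<Rightarrow> complex \<times> complex" where
  "hcoords (Aff x) = (x, 1)"
| "hcoords Infty = (1, 0)"

fun cp1_uminus :: "cp1 \<Rightarrow> cp1" where
  "cp1_uminus (Aff x) = Aff (- x)"
| "cp1_uminus Infty = Infty"

definition p3 :: "'a::comm_ring_1 \<Rightarrow> 'a \<Rightarrow> 'a \<Rightarrow> 'a \<Rightarrow> 'a" where
  "p3 c z x y =
     (let s1 = x + y + z; s2 = x * y + y * z + z * x; s3 = x * y * z in
      s1 ^ 3 - 27 * s3 + 18 * c * s1 ^ 2 * s3 - 54 * c * s2 * s3
        - 27 * c ^ 2 * s2 ^ 2 * s3 + 81 * c ^ 2 * s1 * s3 ^ 2)"

text \<open>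
  The homogenisation of \<open>p3\<close>, of degree 3 in each pair of variables: \<open>sk\<close> is \<open>x\<^sub>0 y\<^sub>0 z\<^sub>0\<close> times the
  elementary symmetric function \<open>\<sigma>\<^sub>k\<close> of the affine coordinates (see \<open>p3_form_affine\<close>). Coefficients
  are polymorphic so that the arguments may be polynomials.
\<close>

fun p3_form :: "'a::comm_ring_1 \<Rightarrow> 'a \<times> 'a \<Rightarrow> 'a \<times> 'a \<Rightarrow> 'a \<times> 'a \<Rightarrow> 'a" where
  "p3_form c (z1, z0) (x1, x0) (y1, y0) =
     (let s0 = x0 * y0 * z0;
          s1 = x1 * y0 * z0 + x0 * y1 * z0 + x0 * y0 * z1;
          s2 = x1 * y1 * z0 + x0 * y1 * z1 + x1 * y0 * z1;
          s3 = x1 * y1 * z1 in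
      s1 ^ 3 - 27 * s3 * s0 ^ 2 + 18 * c * s1 ^ 2 * s3 - 54 * c * s2 * s3 * s0
        - 27 * c ^ 2 * s2 ^ 2 * s3 + 81 * c ^ 2 * s1 * s3 ^ 2)"

lemma p3_form_affine:
  fixes c :: "'a::field"
  assumes "x0 \<noteq> 0" "y0 \<noteq> 0" "z0 \<noteq> 0"
  shows "p3_form c (z1, z0) (x1, x0) (y1, y0) =
    (x0 * y0 * z0) ^ 3 * p3 c (z1 / z0) (x1 / x0) (y1 / y0)"
proof -
  define k x y z where "k = x0 * y0 * z0" and "x = x1 / x0" and "y = y1 / y0" and "z = z1 / z0"
  have [simp]: "x1 = x0 * x" "y1 = y0 * y" "z1 = z0 * z"
    using assms by (simp_all add: x_def y_def z_def)
  have "x1 * y0 * z0 + x0 * y1 * z0 + x0 * y0 * z1 = k * (x + y + z)"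
    "x1 * y1 * z0 + x0 * y1 * z1 + x1 * y0 * z1 = k * (x * y + y * z + z * x)"
    "x1 * y1 * z1 = k * (x * y * z)"
    by (simp_all add: k_def algebra_simps)
  then have "p3_form c (z1, z0) (x1, x0) (y1, y0) = k ^ 3 * p3 c z x y"
    unfolding p3_form.simps p3_def Let_def k_def[symmetric]
    by (simp only:) (simp add: power_mult_distrib algebra_simps power2_eq_square power3_eq_cube)
  then show ?thesis
    by (simp only: k_def x_def y_def z_def)
qed

lemma p3_form_scale:
  "p3_form c (k * z1, k * z0) (l * x1, l * x0) (m * y1, m * y0) =
    (k * l * m) ^ 3 * p3_form c (z1, z0) (x1, x0) (y1, y0)"
proof -
  define q where "q = k * l * m"
  have "l * x0 * (m * y0) * (k * z0) = q * (x0 * y0 * z0)"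
    "l * x1 * (m * y0) * (k * z0) + l * x0 * (m * y1) * (k * z0) + l * x0 * (m * y0) * (k * z1) =
      q * (x1 * y0 * z0 + x0 * y1 * z0 + x0 * y0 * z1)"
    "l * x1 * (m * y1) * (k * z0) + l * x0 * (m * y1) * (k * z1) + l * x1 * (m * y0) * (k * z1) =
      q * (x1 * y1 * z0 + x0 * y1 * z1 + x1 * y0 * z1)"
    "l * x1 * (m * y1) * (k * z1) = q * (x1 * y1 * z1)"
    by (simp_all add: q_def algebra_simps)
  moreover have "(q * b) ^ 3 - 27 * (q * d) * (q * a) ^ 2 + 18 * c * (q * b) ^ 2 * (q * d)
      - 54 * c * (q * e) * (q * d) * (q * a) - 27 * c ^ 2 * (q * e) ^ 2 * (q * d)
      + 81 * c ^ 2 * (q * b) * (q * d) ^ 2 =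
    q ^ 3 * (b ^ 3 - 27 * d * a ^ 2 + 18 * c * b ^ 2 * d - 54 * c * e * d * a
      - 27 * c ^ 2 * e ^ 2 * d + 81 * c ^ 2 * b * d ^ 2)" for a b d e
    by (simp add: algebra_simps power2_eq_square power3_eq_cube)
  ultimately show ?thesis
    unfolding p3_form.simps Let_def q_def[symmetric] by (simp only:)
qed

text \<open>
  The binary cubic form in \<open>Z = (z\<^sub>1, z\<^sub>0)\<close> whose zeros make up the product of \<open>x\<close> and \<open>y\<close>. Zeros are
  counted with multiplicity: those in \<open>\<complex>\<close> in the chart \<open>z\<^sub>0 = 1\<close>, and \<open>\<infinity>\<close> as the zero at \<open>z\<^sub>0 = 0\<close>
  in the chart \<open>z\<^sub>1 = 1\<close>.
\<close>

definition g3_form :: "complex \<Rightarrow> cp1 \<Rightarrow> cp1 \<Rightarrow> complex poly \<times> complex poly \<Rightarrow> complex poly" where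
  "g3_form c x y Z =
     (let (x1, x0) = hcoords x; (y1, y0) = hcoords y in
      p3_form [:c:] Z ([:- x1:], [:x0:]) ([:- y1:], [:y0:]))"

definition g3_mult :: "complex \<Rightarrow> cp1 \<Rightarrow> cp1 \<Rightarrow> cp1 multiset" where
  "g3_mult c x y =
     image_mset Aff (proots (g3_form c x y ([:0, 1:], 1))) +
     replicate_mset (Polynomial.order 0 (g3_form c x y (1, [:0, 1:]))) Infty"

definition G3 :: "complex \<Rightarrow> cp1 mv_group" where
  "G3 c = \<lparr>carrier = UNIV, mv_mult = g3_mult c, mv_one = Aff 0, mv_inv = cp1_uminus\<rparr>"

end

theory Submission
  imports Defs
begin

text \<open>
  The point of the proof is that three elements act on the projective line by translations. If
  \<open>c * h ^ 3 = h\<close>, that is \<open>h = 0\<close> or \<open>h = \<plusminus>1/\<surd>c\<close>, the cubic form that defines \<open>h * m\<close> is the cube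
  of a linear form, whose zero is the image of \<open>m\<close> under the Moebius transformation
  \<open>m \<mapsto> (m + h) / (1 - 3 c h m)\<close> (\<open>g3_mult_translate\<close>). Hence \<open>h * m\<close> is a single point taken three
  times, and \<open>h\<close> is iterating. On the three values of \<open>h\<close> themselves the transformation gives the
  addition table of \<open>\<int>/3\<close>, because \<open>(h + h) / (1 - 3 c h\<^sup>2) = -h\<close> when \<open>c h\<^sup>2 = 1\<close>; the subgroup
  axioms then come from the fact that a diagonal construction is always an n-valued group.

  Conversely, every other \<open>w\<close> has a partner \<open>m\<close> for which the three zeros are distinct. For
  \<open>m = inv w\<close> the form loses its terms of even degree in \<open>z\<^sub>1\<close>: its zeros are \<open>0\<close> and two opposite
  points, and these are distinct unless \<open>c w\<^sup>2 \<in> {0, 1}\<close>, where \<open>w\<close> is one of the translating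
  elements, or \<open>9 c w\<^sup>2 = 1\<close>, or \<open>w = \<infinity>\<close>. In the last two cases the opposite points meet at infinity,
  and another partner has to be chosen. This exception has a geometric reason: the group is the
  quotient of an elliptic curve by an automorphism of order three, the elements \<open>h\<close> are the images
  of its fixed points, and the exceptional \<open>w\<close> are the translates by the \<open>h\<close> of \<open>\<infinity>\<close>, the image of
  the points of order two. A point of order two is its own inverse, so that \<open>w\<close> is then a translate
  of \<open>inv w\<close> and the product of the two has a double element, just as \<open>w * w\<close> has.
\<close>

section \<open>Diagonal constructions are n-valued groups\<close>

lemma sum_mset_replicate_mset_mset:
  "(\<Sum>u\<in>#replicate_mset n a. f u) = repeat_mset n (f a :: 'b multiset)"
  by (induction n) simp_all

lemma n_valued_group_diagonal:
  assumes "group K" "0 < n"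
  shows "n_valued_group n (diagonal_construction n K)"
proof -
  interpret group K by fact
  show ?thesis
    using \<open>0 < n\<close>
    by (auto simp: n_valued_group_def diagonal_construction_def sum_mset_replicate_mset_mset
        m_assoc)
qed

text \<open>
  \<open>mv_group_eq\<close> compares the operations on the carrier only; this suffices because products of
  elements of the carrier of an n-valued group stay there, also in the iterated products of the
  associative law.
\<close>

lemma n_valued_group_cong:
  assumes eq: "mv_group_eq G G'" and G': "n_valued_group n G'"
  shows "n_valued_group n G"
proof -
  have carr: "carrier G = carrier G'" and one: "mv_one G = mv_one G'"
    and mult: "\<And>x y. x \<in> carrier G' \<Longrightarrow> y \<in> carrier G' \<Longrightarrow> mv_mult G x y = mv_mult G' x y"
    and inv: "\<And>x. x \<in> carrier G' \<Longrightarrow> mv_inv G x = mv_inv G' x"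
    using eq by (auto simp: mv_group_eq_def)
  have sub: "u \<in> carrier G'"
    if "x \<in> carrier G'" "y \<in> carrier G'" "u \<in># mv_mult G' x y" for x y u
    using G' that by (auto simp: n_valued_group_def)
  have "(\<Sum>u\<in>#mv_mult G x y. mv_mult G u z) = (\<Sum>u\<in>#mv_mult G' x y. mv_mult G' u z)"
    "(\<Sum>v\<in>#mv_mult G y z. mv_mult G x v) = (\<Sum>v\<in>#mv_mult G' y z. mv_mult G' x v)"
    if "x \<in> carrier G'" "y \<in> carrier G'" "z \<in> carrier G'" for x y z
    using that
    by (auto simp: mult intro!: arg_cong[of _ _ sum_mset] image_mset_cong dest: sub)
  with G' show ?thesis
    unfolding n_valued_group_def carr one by (simp add: mult inv)
qed

section \<open>Zeros of binary cubic forms\<close>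

text \<open>The zeros of \<open>a\<^sub>3 z\<^sub>1\<^sup>3 + a\<^sub>2 z\<^sub>1\<^sup>2 z\<^sub>0 + a\<^sub>1 z\<^sub>1 z\<^sub>0\<^sup>2 + a\<^sub>0 z\<^sub>0\<^sup>3\<close> on the projective line.\<close>

definition cubic_zeros :: "complex \<Rightarrow> complex \<Rightarrow> complex \<Rightarrow> complex \<Rightarrow> cp1 multiset" where
  "cubic_zeros a3 a2 a1 a0 =
     image_mset Aff (proots [:a0, a1, a2, a3:]) +
     replicate_mset (Polynomial.order 0 [:a3, a2, a1, a0:]) Infty"

lemma order_ge_2_imp_double_zero:
  fixes p :: "'a::field poly"
  assumes "Polynomial.order u p \<ge> 2" "p \<noteq> 0"
  shows "poly p u = 0" "poly (pderiv p) u = 0"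
proof -
  have "[:- u, 1:] ^ 2 dvd p"
    using assms order_divides by blast
  then obtain q where q: "p = [:- u, 1:] ^ 2 * q" ..
  define l where "l = [:- u, 1:]"
  have "poly l u = 0" "p = l * (l * q)"
    using q by (simp_all only: l_def power2_eq_square mult.assoc) simp
  then show "poly p u = 0" "poly (pderiv p) u = 0"
    by (simp_all add: pderiv_mult)
qed

text \<open>
  The second alternative is the condition for a double zero at infinity. It also covers the zero
  form, whose zeros \<open>cubic_zeros\<close> does not count in a meaningful way.
\<close>

lemma double_cubic_zero:
  assumes "count (cubic_zeros a3 a2 a1 a0) v \<ge> 2"
  obtains
    (finite) u where "a3 * u ^ 3 + a2 * u ^ 2 + a1 * u + a0 = 0" "3 * a3 * u ^ 2 + 2 * a2 * u + a1 = 0"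
  | (infinite) "a3 = 0" "a2 = 0"
proof (cases "[:a0, a1, a2, a3:] = 0")
  case True
  then show ?thesis
    using infinite by simp
next
  case nz: False
  show ?thesis
  proof (cases v)
    case (Aff u)
    have "count (image_mset Aff A) (Aff u) = count A u" for A
      by (induction A) auto
    then have "Polynomial.order u [:a0, a1, a2, a3:] \<ge> 2"
      using assms nz Aff by (simp add: cubic_zeros_def)
    from order_ge_2_imp_double_zero[OF this nz] show ?thesis
      by (intro finite[of u])
        (simp_all add: pderiv_pCons algebra_simps power2_eq_square power3_eq_cube)
  next
    case Infty
    have "count (image_mset Aff A) Infty = 0" for A
      by (auto simp: count_eq_zero_iff)
    then have "Polynomial.order 0 [:a3, a2, a1, a0:] \<ge> 2"
      using assms Infty by (simp add: cubic_zeros_def)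
    moreover have "[:a3, a2, a1, a0:] \<noteq> 0"
      using nz by auto
    ultimately show ?thesis
      using order_ge_2_imp_double_zero[of 0 "[:a3, a2, a1, a0:]"]
      by (intro infinite) (simp_all add: pderiv_pCons)
  qed
qed

lemma cubic_zeros_cube:
  assumes "p \<noteq> 0 \<or> q \<noteq> 0"
  shows "cubic_zeros (p ^ 3) (- 3 * p ^ 2 * q) (3 * p * q ^ 2) (- (q ^ 3)) =
    replicate_mset 3 (if p = 0 then Infty else Aff (q / p))"
proof (cases "p = 0")
  case True
  have "[:0, 0, 0, - (q ^ 3):] = monom (- (q ^ 3)) 3"
    by (simp add: monom_altdef power3_eq_cube)
  then have "Polynomial.order 0 [:0, 0, 0, - (q ^ 3):] = 3"
    using assms True by simp
  then show ?thesis
    using True by (simp add: cubic_zeros_def)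
next
  case False
  \<comment> \<open>In the chart \<open>z\<^sub>0 = 1\<close> the form is the cube of \<open>p z - q\<close>.\<close>
  have cube: "[:- (q ^ 3), 3 * p * q ^ 2, - 3 * p ^ 2 * q, p ^ 3:] = [:p ^ 3:] * [:- (q / p), 1:] ^ 3"
    using False by (simp add: power3_eq_cube power2_eq_square field_simps)
  have "proots ([:p ^ 3:] * [:- (q / p), 1:] ^ 3) = replicate_mset 3 (q / p)"
    using False by (simp add: proots_mult proots_power)
  moreover have "Polynomial.order 0 [:p ^ 3, - 3 * p ^ 2 * q, 3 * p * q ^ 2, - (q ^ 3):] = 0"
    using False by (intro order_0I) simp
  ultimately show ?thesis
    using False unfolding cubic_zeros_def cube by simp
qed

section \<open>The cubic form of a product\<close>

text \<open>
  The form depends on \<open>x\<close> and \<open>y\<close> only through the homogenised elementary symmetric functions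
  \<open>q\<close>, \<open>s\<close>, \<open>r\<close> (degrees 0, 1, 2) of the coordinates of \<open>inv x\<close> and \<open>inv y\<close>.
\<close>

lemma g3_mult_eq_cubic_zeros:
  assumes "hcoords x = (x1, x0)" "hcoords y = (y1, y0)"
    and "q = x0 * y0" "s = - (x1 * y0 + x0 * y1)" "r = x1 * y1"
  shows "g3_mult c x y = cubic_zeros
    (q ^ 3 + 18 * c * r * q ^ 2 - 27 * c ^ 2 * s ^ 2 * r + 81 * c ^ 2 * r ^ 2 * q)
    (3 * s * (q - 3 * c * r) ^ 2)
    (3 * s ^ 2 * q - 27 * r * q ^ 2 + 18 * c * s ^ 2 * r - 54 * c * r ^ 2 * q - 27 * c ^ 2 * r ^ 3)
    (s ^ 3)"
proof -
  have num: "numeral k = [:numeral k :: complex:]" for k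
    by (simp add: numeral_poly)
  have "g3_form c x y ([:0, 1:], 1) =
    [:s ^ 3,
      3 * s ^ 2 * q - 27 * r * q ^ 2 + 18 * c * s ^ 2 * r - 54 * c * r ^ 2 * q - 27 * c ^ 2 * r ^ 3,
      3 * s * (q - 3 * c * r) ^ 2,
      q ^ 3 + 18 * c * r * q ^ 2 - 27 * c ^ 2 * s ^ 2 * r + 81 * c ^ 2 * r ^ 2 * q:]"
    unfolding g3_form_def assms(1,2) Let_def prod.case p3_form.simps assms(3-5)
    by (simp add: num power2_eq_square power3_eq_cube algebra_simps)
  moreover have "g3_form c x y (1, [:0, 1:]) =
    [:q ^ 3 + 18 * c * r * q ^ 2 - 27 * c ^ 2 * s ^ 2 * r + 81 * c ^ 2 * r ^ 2 * q,
      3 * s * (q - 3 * c * r) ^ 2,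
      3 * s ^ 2 * q - 27 * r * q ^ 2 + 18 * c * s ^ 2 * r - 54 * c * r ^ 2 * q - 27 * c ^ 2 * r ^ 3,
      s ^ 3:]"
    unfolding g3_form_def assms(1,2) Let_def prod.case p3_form.simps assms(3-5)
    by (simp add: num power2_eq_square power3_eq_cube algebra_simps)
  ultimately show ?thesis
    by (simp add: g3_mult_def cubic_zeros_def)
qed

lemma g3_mult_commute: "g3_mult c x y = g3_mult c y x"
proof -
  obtain x1 x0 y1 y0 where *: "hcoords x = (x1, x0)" "hcoords y = (y1, y0)"
    by (metis surj_pair)
  show ?thesis
    unfolding g3_mult_eq_cubic_zeros[OF * refl refl refl]
      g3_mult_eq_cubic_zeros[OF *(2,1) refl refl refl]
    by (simp add: ac_simps)
qed

section \<open>Translations\<close>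

text \<open>
  The Moebius transformation \<open>m \<mapsto> (m + h) / (1 - 3 c h m)\<close>, in homogeneous coordinates so that
  \<open>m = \<infinity>\<close> needs no separate treatment.
\<close>

definition translate :: "complex \<Rightarrow> complex \<Rightarrow> cp1 \<Rightarrow> cp1" where
  "translate c h m =
     (let (y1, y0) = hcoords m; d = y0 - 3 * c * h * y1 in
      if d = 0 then Infty else Aff ((y1 + h * y0) / d))"

lemma hcoords_nonzero: "hcoords m = (y1, y0) \<Longrightarrow> y1 \<noteq> 0 \<or> y0 \<noteq> 0"
  by (cases m) auto

text \<open>
  When \<open>c h\<^sup>3 = h\<close>, the three values of the product with \<open>h\<close> coincide because the form is a cube.
  The transformation is then invertible, which excludes the zero form: its determinant
  \<open>1 + 3 c h\<^sup>2\<close> is \<open>1\<close> or \<open>4\<close>.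
\<close>

lemma g3_mult_translate:
  assumes h: "c * h ^ 3 = h"
  shows "g3_mult c (Aff h) m = replicate_mset 3 (translate c h m)"
proof -
  obtain y1 y0 where m: "hcoords m = (y1, y0)"
    by fastforce
  define p q where "p = y0 - 3 * c * h * y1" and "q = y1 + h * y0"
  have ch2: "h = 0 \<or> c * h ^ 2 = 1"
    using h by (auto simp: power3_eq_cube power2_eq_square)
  have "p \<noteq> 0 \<or> q \<noteq> 0"
  proof (rule ccontr)
    assume "\<not> (p \<noteq> 0 \<or> q \<noteq> 0)"
    then have "y1 = - h * y0" and "y0 * (1 + 3 * (c * h ^ 2)) = 0"
      unfolding p_def q_def by algebra+
    with ch2 hcoords_nonzero[OF m] show False
      by auto
  qed
  moreover have "g3_mult c (Aff h) m = cubic_zeros (p ^ 3) (- 3 * p ^ 2 * q) (3 * p * q ^ 2) (- (q ^ 3))"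
  proof -
    \<comment> \<open>The form differs from the cube of \<open>p z\<^sub>1 - q z\<^sub>0\<close> by multiples of \<open>c h\<^sup>3 - h\<close> only.\<close>
    define k where "k = 27 * (c * h ^ 3 - h) * y1 * (y0 ^ 2 - c * y1 ^ 2)"
    have "k = 0"
      using h by (simp add: k_def)
    have "y0 ^ 3 + 18 * c * (h * y1) * y0 ^ 2 - 27 * c ^ 2 * (- q) ^ 2 * (h * y1)
        + 81 * c ^ 2 * (h * y1) ^ 2 * y0 = p ^ 3 - c * k"
      unfolding p_def q_def k_def by algebra
    then have "y0 ^ 3 + 18 * c * (h * y1) * y0 ^ 2 - 27 * c ^ 2 * (- q) ^ 2 * (h * y1)
        + 81 * c ^ 2 * (h * y1) ^ 2 * y0 = p ^ 3"
      by (simp add: \<open>k = 0\<close>)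
    moreover have "3 * (- q) * (y0 - 3 * c * (h * y1)) ^ 2 = - 3 * p ^ 2 * q"
      unfolding p_def by algebra
    moreover have "3 * (- q) ^ 2 * y0 - 27 * (h * y1) * y0 ^ 2 + 18 * c * (- q) ^ 2 * (h * y1)
        - 54 * c * (h * y1) ^ 2 * y0 - 27 * c ^ 2 * (h * y1) ^ 3 = 3 * p * q ^ 2"
    proof -
      have "3 * (- q) ^ 2 * y0 - 27 * (h * y1) * y0 ^ 2 + 18 * c * (- q) ^ 2 * (h * y1)
          - 54 * c * (h * y1) ^ 2 * y0 - 27 * c ^ 2 * (h * y1) ^ 3 = 3 * p * q ^ 2 + k"
        unfolding p_def q_def k_def by algebra
      then show ?thesis
        by (simp add: \<open>k = 0\<close>)
    qed
    moreover have "(- q) ^ 3 = - (q ^ 3)"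
      by simp
    moreover have "y0 = 1 * y0" "- q = - (h * y0 + 1 * y1)"
      by (simp_all add: q_def)
    ultimately show ?thesis
      using g3_mult_eq_cubic_zeros[of "Aff h" h 1 m y1 y0 y0 "- q" "h * y1" c] m by simp
  qed
  ultimately show ?thesis
    using cubic_zeros_cube[of p q]
    by (simp only: translate_def m Let_def prod.case flip: p_def q_def)
qed

section \<open>The iterating elements\<close>

lemma iterating_translation:
  assumes "c * h ^ 3 = h"
  shows "iterating (G3 c) (Aff h)"
proof -
  have "count (g3_mult c (Aff h) m) (translate c h m) \<ge> 2" for m
    by (simp add: g3_mult_translate[OF assms])
  then show ?thesis
    unfolding iterating_def G3_def by (auto simp: g3_mult_commute[of c _ "Aff h"])
qed

text \<open>
  For \<open>w = \<infinity>\<close> all but finitely many partners would do. With \<open>-2/\<surd>c\<close>, and with \<open>t = 3 \<surd>c u\<close> for a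
  finite zero \<open>u\<close>, the form becomes \<open>2 t\<^sup>3 - 12 t\<^sup>2 + 60 t - 1\<close>, which has no common zero with its
  derivative.
\<close>

lemma not_iterating_Infty:
  assumes "c \<noteq> 0"
  shows "\<not> iterating (G3 c) Infty"
proof
  define e where "e = csqrt c"
  have c: "c = e ^ 2" and "e \<noteq> 0"
    using assms by (simp_all add: e_def)
  assume "iterating (G3 c) Infty"
  then obtain v where "count (g3_mult c Infty (Aff (- 2 / e))) v \<ge> 2"
    by (auto simp: iterating_def G3_def)
  moreover have "g3_mult c Infty (Aff (- 2 / e)) = cubic_zeros (54 * e ^ 3) (- 108 * e ^ 2) (180 * e) (- 1)"
    using \<open>e \<noteq> 0\<close>
    by (subst g3_mult_eq_cubic_zeros[of _ 1 0 _ "- 2 / e" 1 0 "- 1" "- 2 / e"])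
      (simp_all add: c field_simps power2_eq_square power3_eq_cube)
  ultimately have "count (cubic_zeros (54 * e ^ 3) (- 108 * e ^ 2) (180 * e) (- 1)) v \<ge> 2"
    by simp
  then show False
  proof (cases rule: double_cubic_zero)
    case (finite u)
    define t where "t = 3 * e * u"
    have "2 * t ^ 3 - 12 * t ^ 2 + 60 * t - 1 = 0"
      using finite(1) unfolding t_def by algebra
    moreover have "t ^ 2 - 4 * t + 10 = 0"
    proof -
      have "18 * e * (t ^ 2 - 4 * t + 10) = 0"
        using finite(2) unfolding t_def by algebra
      with \<open>e \<noteq> 0\<close> show ?thesis
        by simp
    qed
    ultimately show False
      by algebra
  next
    case infinite
    with \<open>e \<noteq> 0\<close> show False
      by simp
  qed
qed

text \<open>
  Here, too, all but finitely many partners would do. With \<open>-9 x\<close> and \<open>t = u / x\<close> for a finite zero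
  \<open>u\<close>, the form becomes a nonzero multiple of \<open>4 t\<^sup>3 + 6 t\<^sup>2 - 15 t + 8\<close>, which has no common zero with its derivative.
\<close>

lemma not_iterating_ninth:
  assumes x: "9 * c * x ^ 2 = 1"
  shows "\<not> iterating (G3 c) (Aff x)"
proof
  have "x \<noteq> 0"
    using x by auto
  then have c: "c = 1 / (9 * x ^ 2)"
    using x by (simp add: field_simps)
  assume "iterating (G3 c) (Aff x)"
  then obtain v where "count (g3_mult c (Aff x) (Aff (- 9 * x))) v \<ge> 2"
    by (auto simp: iterating_def G3_def)
  moreover have "g3_mult c (Aff x) (Aff (- 9 * x)) =
      cubic_zeros 256 (384 * x) (- 960 * x ^ 2) (512 * x ^ 3)"
    using \<open>x \<noteq> 0\<close>
    by (subst g3_mult_eq_cubic_zeros[of _ x 1 _ "- 9 * x" 1 1 "8 * x" "- 9 * x ^ 2"])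
      (simp_all add: c field_simps power2_eq_square power3_eq_cube)
  ultimately have "count (cubic_zeros 256 (384 * x) (- 960 * x ^ 2) (512 * x ^ 3)) v \<ge> 2"
    by simp
  then show False
  proof (cases rule: double_cubic_zero)
    case (finite u)
    define t where "t = u / x"
    have u: "u = t * x"
      using \<open>x \<noteq> 0\<close> by (simp add: t_def)
    have "64 * x ^ 3 * (4 * t ^ 3 + 6 * t ^ 2 - 15 * t + 8) = 0"
      using finite(1) unfolding u by algebra
    moreover have "192 * x ^ 2 * (4 * t ^ 2 + 4 * t - 5) = 0"
      using finite(2) unfolding u by algebra
    ultimately have "4 * t ^ 3 + 6 * t ^ 2 - 15 * t + 8 = 0" "4 * t ^ 2 + 4 * t - 5 = 0"
      using \<open>x \<noteq> 0\<close> by simp_all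
    then show False
      by algebra
  next
    case infinite
    then show False
      by simp
  qed
qed

text \<open>
  The partner \<open>-x\<close> leaves the form \<open>(1 + 9 c r)\<^sup>2 z\<^sub>1\<^sup>3 + a z\<^sub>1 z\<^sub>0\<^sup>2\<close> with \<open>r = -x\<^sup>2\<close>. The leading
  coefficient is nonzero by the preceding case, and a double zero then forces \<open>a = 0\<close>, which is the equation of the translating
  elements.
\<close>

lemma iterating_imp_translation:
  assumes "c \<noteq> 0" "iterating (G3 c) w"
  obtains h where "w = Aff h" "c * h ^ 3 = h"
proof (cases w)
  case Infty
  with assms not_iterating_Infty show ?thesis
    by simp
next
  case (Aff x)
  define r where "r = - (x ^ 2)"
  define a where "a = - 27 * r * (1 + c * r) ^ 2"
  have ninth: "1 + 9 * c * r \<noteq> 0"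
    using assms not_iterating_ninth[of c x] Aff by (auto simp: r_def)
  obtain v where "count (g3_mult c (Aff x) (Aff (- x))) v \<ge> 2"
    using assms(2) Aff by (auto simp: iterating_def G3_def)
  moreover have "g3_mult c (Aff x) (Aff (- x)) = cubic_zeros ((1 + 9 * c * r) ^ 2) 0 a 0"
    by (subst g3_mult_eq_cubic_zeros[of _ x 1 _ "- x" 1 1 0 r])
      (simp_all add: r_def a_def algebra_simps power2_eq_square power3_eq_cube)
  ultimately have "count (cubic_zeros ((1 + 9 * c * r) ^ 2) 0 a 0) v \<ge> 2"
    by simp
  then have "a = 0"
  proof (cases rule: double_cubic_zero)
    case (finite u)
    then have "(1 + 9 * c * r) ^ 2 * u ^ 3 = 0"
      by algebra
    with ninth finite(2) show ?thesis
      by simp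
  next
    case infinite
    with ninth show ?thesis
      by simp
  qed
  then have "x = 0 \<or> c * x ^ 2 = 1"
    by (auto simp: a_def r_def)
  then have "c * x ^ 3 = x"
    by (auto simp: power3_eq_cube power2_eq_square)
  with Aff that show ?thesis
    by blast
qed

lemma iterating_G3_iff:
  assumes "c \<noteq> 0"
  shows "iterating (G3 c) w \<longleftrightarrow> (\<exists>h. w = Aff h \<and> c * h ^ 3 = h)"
  using iterating_imp_translation[OF assms] iterating_translation by metis

section \<open>The group of translations\<close>

text \<open>
  For \<open>c e\<^sup>2 = 1\<close> the carrier consists of all \<open>h\<close> with \<open>c h\<^sup>3 = h\<close>, listed in the order of the
  residues \<open>0, 1, 2\<close>. The product \<open>\<infinity> \<otimes> y\<close>, outside the carrier, is arbitrary.
\<close>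

definition translation_group :: "complex \<Rightarrow> complex \<Rightarrow> cp1 monoid" where
  "translation_group c e =
     \<lparr>carrier = {Aff 0, Aff e, Aff (- e)},
      monoid.mult = (\<lambda>x y. case x of Aff h \<Rightarrow> translate c h y | Infty \<Rightarrow> Infty),
      one = Aff 0\<rparr>"

lemma translate_table:
  assumes "c * e ^ 2 = 1"
  shows "translate c 0 (Aff h) = Aff h" "translate c h (Aff 0) = Aff h"
    "translate c e (Aff e) = Aff (- e)" "translate c e (Aff (- e)) = Aff 0"
    "translate c (- e) (Aff e) = Aff 0" "translate c (- e) (Aff (- e)) = Aff e"
proof -
  show "translate c 0 (Aff h) = Aff h" "translate c h (Aff 0) = Aff h"
    by (auto simp: translate_def)
  have tr: "translate c h (Aff m) =
      (if 1 - 3 * c * h * m = 0 then Infty else Aff ((m + h) / (1 - 3 * c * h * m)))" for h m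
    by (simp add: translate_def)
  have "1 - 3 * c * e * e = 1 - 3 * (c * e ^ 2)" "1 - 3 * c * e * (- e) = 1 + 3 * (c * e ^ 2)"
    "1 - 3 * c * (- e) * e = 1 + 3 * (c * e ^ 2)" "1 - 3 * c * (- e) * (- e) = 1 - 3 * (c * e ^ 2)"
    by (simp_all add: power2_eq_square)
  then have denom: "1 - 3 * c * e * e = - 2" "1 - 3 * c * e * (- e) = 4"
    "1 - 3 * c * (- e) * e = 4" "1 - 3 * c * (- e) * (- e) = - 2"
    unfolding assms by simp_all
  show "translate c e (Aff e) = Aff (- e)" "translate c e (Aff (- e)) = Aff 0"
    "translate c (- e) (Aff e) = Aff 0" "translate c (- e) (Aff (- e)) = Aff e"
    unfolding tr denom by simp_all
qed

lemma group_translation_group: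
  assumes "c * e ^ 2 = 1"
  shows "group (translation_group c e)"
  by (rule groupI)
    (auto simp: translation_group_def translate_table[OF assms])

lemma translation_group_iso:
  assumes "c * e ^ 2 = 1"
  shows "translation_group c e \<cong> integer_mod_group 3"
proof -
  define f where "f w = (if w = Aff 0 then 0 else if w = Aff e then 1 else 2 :: int)" for w
  have [simp]: "e \<noteq> 0" and "e \<noteq> - e"
    using assms by auto
  then have f: "f (Aff 0) = 0" "f (Aff e) = 1" "f (Aff (- e)) = 2"
    by (auto simp: f_def)
  have carr: "carrier (integer_mod_group 3) = {0, 1, 2}"
    by (auto simp: carrier_integer_mod_group)
  have "f \<in> iso (translation_group c e) (integer_mod_group 3)"
    unfolding iso_def hom_def bij_betw_def carr
    by (auto simp: translation_group_def f translate_table[OF assms] integer_mod_group_def inj_on_def)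
  then show ?thesis
    by (rule is_isoI)
qed

lemma translation_group_diagonal:
  assumes "c * e ^ 2 = 1"
  shows "mv_group_eq ((G3 c)\<lparr>carrier := {Aff 0, Aff e, Aff (- e)}\<rparr>)
    (diagonal_construction 3 (translation_group c e))"
proof -
  interpret K: group "translation_group c e"
    by (rule group_translation_group[OF assms])
  have h3: "c * h ^ 3 = h" if "h \<in> {0, e, - e}" for h
    using that assms by (auto simp: power3_eq_cube power2_eq_square)
  have inv: "cp1_uminus x = inv\<^bsub>translation_group c e\<^esub> x" if "x \<in> {Aff 0, Aff e, Aff (- e)}" for x
    by (rule K.inv_equality[symmetric])
      (use that in \<open>auto simp: translation_group_def translate_table[OF assms]\<close>)
  show ?thesis
    unfolding mv_group_eq_def
    by (auto simp: G3_def diagonal_construction_def translation_group_def g3_mult_translate h3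
        inv[unfolded translation_group_def])
qed

theorem proposition5:
  fixes c :: complex
  assumes "c \<noteq> 0"
  shows "{w. iterating (G3 c) w} = {Aff 0, Aff (1 / csqrt c), Aff (- (1 / csqrt c))} \<and>
    n_valued_subgroup 3 {w. iterating (G3 c) w} (G3 c) \<and>
    (\<exists>K :: cp1 monoid. group K \<and> K \<cong> integer_mod_group 3 \<and>
       mv_group_eq ((G3 c)\<lparr>carrier := {w. iterating (G3 c) w}\<rparr>) (diagonal_construction 3 K))"
proof -
  define e where "e = 1 / csqrt c"
  have e: "c * e ^ 2 = 1"
    using assms by (simp add: e_def power_divide)
  have "c * h ^ 3 = h \<longleftrightarrow> h \<in> {0, e, - e}" for h
  proof -
    have "c * h ^ 3 - h = c * (h * (h - e) * (h + e))"
      using e by algebra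
    then have "c * h ^ 3 = h \<longleftrightarrow> c * (h * (h - e) * (h + e)) = 0"
      by (metis eq_iff_diff_eq_0)
    then show ?thesis
      using assms by (auto simp: eq_neg_iff_add_eq_0)
  qed
  then have iter: "{w. iterating (G3 c) w} = {Aff 0, Aff e, Aff (- e)}"
    by (auto simp: iterating_G3_iff[OF assms])
  note K = group_translation_group[OF e] translation_group_iso[OF e] translation_group_diagonal[OF e]
  have "n_valued_subgroup 3 {Aff 0, Aff e, Aff (- e)} (G3 c)"
    using n_valued_group_cong[OF K(3) n_valued_group_diagonal[OF K(1)]]
    by (simp add: n_valued_subgroup_def G3_def)
  with K show ?thesis
    unfolding iter by (auto simp: e_def)
qed

end
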